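(* For every integer $d \ge 2$, there exists a graph $G$ with maximum degree $d$ and a partition $\mathcal{P}$ of $V(G)$ such that $|V_i| = 2d-1$ for every $V_i \in \mathcal{P}$, $G$ has no independent transversal with respect to $\mathcal{P}$, and no connected component of $G$ that is isomorphic to $K_{d,d}$ is contained in the union $V_i \cup V_j$ of two blocks $V_i, V_j \in \mathcal{P}$.
   Context: Graphs are finite and simple. For a graph $G$ and a partition $\mathcal{P} = \{V_1, \ldots, V_r\}$ of $V(G)$ into blocks, an independent transversal (IT) of $G$ with respect to $\mathcal{P}$ is an independent set $\{v_1, \ldots, v_r\}$ of $G$ with $v_i \in V_i$ for every $i$. $K_{d,d}$ is the complete bipartite graph with parts of size $d$. *)

theory Defs
  imports "HOL-Library.Disjoint_Sets" "Graph_Theory.Kuratowski"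
begin

text \<open>
  A finite simple graph is a digraph satisfying the locale predicate \<^const>\<open>graph\<close>: finite,
  loop-free, without parallel arcs, and symmetric. Each undirected edge is a pair of opposite arcs,
  so the degree of a vertex is its out-degree.
\<close>

text \<open>Only meaningful when the graph has at least one vertex (\<^const>\<open>Max\<close> of the empty set
  is unspecified).\<close>
definition max_degree :: "('a, 'b) pre_digraph \<Rightarrow> nat" where
  "max_degree G = Max (out_degree G ` verts G)"

definition independent_set :: "('a, 'b) pre_digraph \<Rightarrow> 'a set \<Rightarrow> bool" where
  "independent_set G S \<longleftrightarrow> S \<subseteq> verts G \<and> (\<forall>u\<in>S. \<forall>v\<in>S. (u, v) \<notin> arcs_ends G)"

definition independent_transversal ::
    "('a, 'b) pre_digraph \<Rightarrow> 'a set set \<Rightarrow> 'a set \<Rightarrow> bool" where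
  "independent_transversal G P S \<longleftrightarrow>
     independent_set G S \<and> (\<exists>f. (\<forall>B\<in>P. f B \<in> B) \<and> S = f ` P)"

text \<open>Maximal connected subgraphs. The qualified name avoids the topological notion
  of connectedness.\<close>
definition connected_component :: "('a, 'b) pre_digraph \<Rightarrow> ('a, 'b) pre_digraph \<Rightarrow> bool" where
  "connected_component G H \<longleftrightarrow> pre_digraph.max_subgraph G Digraph_Component.connected H"

end

theory Submission
  imports Defs "HOL-Library.Countable"
begin

text \<open>
  Read vertices as literal occurrences, blocks as clauses, and join complementary occurrences: the
  graph is then a disjoint union of bicliques, one per variable, and an independent transversal is
  a satisfying assignment. So it suffices to find an unsatisfiable formula whose clauses have
  \<open>2d - 1\<close> literals (with multiplicity), in which every literal occurs at most \<open>d\<close> times, and in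
  which every variable whose two literals both occur \<open>d\<close> times meets at least three clauses.

  Take variables \<open>x\<^sub>0, \<dots>, x\<^sub>d\<close>, the link clauses \<open>\<not> x\<^sub>i \<or> x\<^sub>i\<^sub>+\<^sub>1\<close> for \<open>i < d\<close>, with
  multiplicities \<open>d\<close> and \<open>d - 1\<close>, and the hub clause \<open>x\<^sub>0 \<or> \<dots> \<or> x\<^sub>d\<close>, with multiplicity \<open>d - 1\<close>
  for \<open>x\<^sub>0\<close> and 1 for the others. Together they force \<open>x\<^sub>d\<close>. Two copies in which \<open>x\<^sub>d\<close> is replaced
  by \<open>z\<close> and by \<open>\<not> z\<close> are contradictory. Since \<open>x\<^sub>0\<close> occurs only \<open>d - 1\<close> times positively, it
  spans no \<open>K\<^sub>d\<^sub>,\<^sub>d\<close>; for \<open>0 < i < d\<close> the variable \<open>x\<^sub>i\<close> occurs in two links and the hub, and \<open>z\<close>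
  occurs in a link and a hub of each copy.
\<close>

definition biclique_graph :: "'a set \<Rightarrow> ('a \<Rightarrow> 'l) \<Rightarrow> ('l \<Rightarrow> 'l) \<Rightarrow> ('a, 'a \<times> 'a) pre_digraph" where
  "biclique_graph V lit opp =
     \<lparr>verts = V, arcs = {(u, v). u \<in> V \<and> v \<in> V \<and> lit v = opp (lit u)}, tail = fst, head = snd\<rparr>"

definition occurrences :: "'a set \<Rightarrow> ('a \<Rightarrow> 'l) \<Rightarrow> 'l \<Rightarrow> 'a set" where
  "occurrences V lit l = {v \<in> V. lit v = l}"

lemma verts_biclique_graph [simp]: "verts (biclique_graph V lit opp) = V"
  by (simp add: biclique_graph_def)

lemma arcs_ends_biclique_graph:
  "(u, v) \<in> arcs_ends (biclique_graph V lit opp) \<longleftrightarrow> u \<in> V \<and> v \<in> V \<and> lit v = opp (lit u)"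
  by (force simp: arcs_ends_conv biclique_graph_def)

lemma graph_biclique_graph:
  assumes "finite V" and invol: "\<And>l. opp (opp l) = l" and "\<And>l. opp l \<noteq> l"
  shows "graph (biclique_graph V lit opp)"
proof -
  have "finite {(u, v). u \<in> V \<and> v \<in> V \<and> lit v = opp (lit u)}"
    by (rule finite_subset[of _ "V \<times> V"]) (use assms in auto)
  moreover have "symmetric (biclique_graph V lit opp)"
    unfolding symmetric_def by (rule symI) (auto simp: arcs_ends_biclique_graph invol)
  ultimately show ?thesis
    using assms
    by unfold_locales (auto simp: biclique_graph_def arc_to_ends_def, metis)
qed

lemma out_degree_biclique_graph:
  assumes "v \<in> V"
  shows "out_degree (biclique_graph V lit opp) v = card (occurrences V lit (opp (lit v)))"
proof -
  have "out_arcs (biclique_graph V lit opp) v = Pair v ` occurrences V lit (opp (lit v))"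
    using assms by (auto simp: out_arcs_def biclique_graph_def occurrences_def)
  then show ?thesis
    by (simp add: out_degree_def card_image inj_on_def)
qed

text \<open>A \<open>K\<^sub>d\<^sub>,\<^sub>d\<close> in a graph of maximum degree at most \<open>d\<close> contains all neighbours of its
  vertices, so maximality of the component is automatic.\<close>
lemma complete_bipartite_subgraph_biclique_graph:
  assumes fin: "finite V" and invol: "\<And>l. opp (opp l) = l"
    and le: "\<And>l. card (occurrences V lit l) \<le> d" and "d > 0"
    and sub: "subgraph H (biclique_graph V lit opp)"
    and K: "complete_bipartite_digraph d d H"
  obtains l where "verts H = occurrences V lit l \<union> occurrences V lit (opp l)"
    "card (occurrences V lit l) = d" "card (occurrences V lit (opp l)) = d"
proof -
  obtain A B where AB: "verts H = A \<union> B" "card A = d" "card B = d"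
      "arcs_ends H = A \<times> B \<union> B \<times> A"
    using K unfolding complete_bipartite_digraph_def by blast
  have edge: "u \<in> V \<and> v \<in> V \<and> lit v = opp (lit u)" if "(u, v) \<in> arcs_ends H" for u v
    using subsetD[OF arcs_ends_mono[OF sub] that] arcs_ends_biclique_graph[of u v V lit opp] by simp
  have fin_occ: "finite (occurrences V lit l)" for l
    using fin by (simp add: occurrences_def)
  obtain a b where ab: "a \<in> A" "b \<in> B"
    using AB \<open>d > 0\<close> by (metis card.empty ex_in_conv less_irrefl)
  have "B \<subseteq> occurrences V lit (opp (lit a))"
    using edge ab AB by (auto simp: occurrences_def)
  \<comment> \<open>\<open>B\<close> has \<open>d\<close> elements and no literal occurs more
    often.\<close>
  then have B: "B = occurrences V lit (opp (lit a))"
    using le AB fin_occ by (metis card_seteq)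
  have "lit b = opp (lit a)"
    using edge ab AB by auto
  then have "A \<subseteq> occurrences V lit (lit a)"
    using edge[of b] ab AB by (auto simp: occurrences_def invol)
  then have "A = occurrences V lit (lit a)"
    using le AB fin_occ by (metis card_seteq)
  with B AB show ?thesis
    by (intro that[of "lit a"]) auto
qed

text \<open>The vertex \<open>(s, i, k)\<close> is slot \<open>k\<close> of clause \<open>i\<close> of copy \<open>s\<close>, clause \<open>d\<close> being the hub; the
  literal \<open>(s, j, b)\<close> is \<open>x\<^sub>j\<close> of copy \<open>s\<close> if \<open>b\<close> and its negation otherwise, except that
  the negation of \<open>x\<^sub>d\<close> is \<open>x\<^sub>d\<close> of the other copy. In the hub the subtraction truncates,
  so that the slots \<open>k \<le> d - 2\<close> all carry \<open>x\<^sub>0\<close>.\<close>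

fun slot_literal :: "nat \<Rightarrow> bool \<times> nat \<times> nat \<Rightarrow> bool \<times> nat \<times> bool" where
  "slot_literal d (s, i, k) =
     (if i = d then (s, k + 2 - d, True) else if k < d then (s, i, False) else (s, Suc i, True))"

fun opposite :: "nat \<Rightarrow> bool \<times> nat \<times> bool \<Rightarrow> bool \<times> nat \<times> bool" where
  "opposite d (s, j, b) = (if j = d then (\<not> s, j, b) else (s, j, \<not> b))"

text \<open>Encoded by \<open>to_nat\<close>, since the vertices are to be naturals.\<close>

definition slots :: "nat \<Rightarrow> nat set" where
  "slots d = to_nat ` (UNIV \<times> {..d} \<times> {..<2 * d - 1} :: (bool \<times> nat \<times> nat) set)"

definition clause :: "nat \<Rightarrow> bool \<times> nat \<Rightarrow> nat set" where
  "clause d c = (\<lambda>k. to_nat (fst c, snd c, k)) ` {..<2 * d - 1}"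

definition literal :: "nat \<Rightarrow> nat \<Rightarrow> bool \<times> nat \<times> bool" where
  "literal d = slot_literal d \<circ> from_nat"

lemma opposite_opposite: "opposite d (opposite d l) = l"
  by (cases l) auto

lemma opposite_neq: "opposite d l \<noteq> l"
  by (cases l) auto

lemma finite_slots: "finite (slots d)"
  by (simp add: slots_def)

lemma literal_to_nat [simp]: "literal d (to_nat v) = slot_literal d v"
  by (simp add: literal_def)

lemma to_nat_in_slots [simp]: "to_nat (s, i, k) \<in> slots d \<longleftrightarrow> i \<le> d \<and> k < 2 * d - 1"
  for s :: bool and i k :: nat
  by (auto simp: slots_def)

lemma occurrences_slots:
  "occurrences (slots d) (literal d) l =
     to_nat ` {(s, i, k). i \<le> d \<and> k < 2 * d - 1 \<and> slot_literal d (s, i, k) = l}"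
  by (auto simp: occurrences_def slots_def)

lemma occurrences_negative:
  assumes "d \<ge> 2"
  shows "card (occurrences (slots d) (literal d) (s, j, False)) = (if j < d then d else 0)"
proof -
  have "{(s', i, k). i \<le> d \<and> k < 2 * d - 1 \<and> slot_literal d (s', i, k) = (s, j, False)} =
      (if j < d then (\<lambda>k. (s, j, k)) ` {..<d} else {})"
    using assms by (auto split: if_splits)
  then show ?thesis
    by (simp add: occurrences_slots card_image inj_on_def)
qed

lemma occurrences_positive:
  assumes "d \<ge> 2"
  shows "card (occurrences (slots d) (literal d) (s, j, True)) =
    (if j = 0 then d - 1 else if j \<le> d then d else 0)"
proof -
  have eq: "{(s', i, k). i \<le> d \<and> k < 2 * d - 1 \<and> slot_literal d (s', i, k) = (s, j, True)} =
      (if j = 0 then (\<lambda>k. (s, d, k)) ` {..<d - 1}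
       else if j \<le> d then insert (s, d, j + d - 2) ((\<lambda>k. (s, j - 1, k)) ` {d..<2 * d - 1})
       else {})"
    using assms by (auto split: if_splits)
  have "(s, d, j + d - 2) \<notin> (\<lambda>k. (s, j - 1, k)) ` {d..<2 * d - 1}" if "j \<le> d"
    using that assms by auto
  with assms show ?thesis
    unfolding occurrences_slots eq card_image[OF inj_on_subset[OF inj_to_nat subset_UNIV]]
    by (simp add: card_image inj_on_def)
qed

lemma partition_on_clauses:
  assumes "d \<ge> 2"
  shows "partition_on (slots d) (clause d ` (UNIV \<times> {..d}))"
  using assms
  by (intro partition_onI)
    (auto simp: clause_def slots_def image_iff disjnt_iff lessThan_empty_iff)

lemma card_clause: "card (clause d c) = 2 * d - 1"
  by (simp add: clause_def card_image inj_on_def)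

lemma no_independent_transversal:
  "\<not> independent_transversal (biclique_graph (slots d) (literal d) (opposite d))
       (clause d ` (UNIV \<times> {..d})) S"
proof
  assume "independent_transversal (biclique_graph (slots d) (literal d) (opposite d))
       (clause d ` (UNIV \<times> {..d})) S"
  then obtain f where
      S: "independent_set (biclique_graph (slots d) (literal d) (opposite d)) S"
        "S = f ` clause d ` (UNIV \<times> {..d})"
      and f: "\<forall>B \<in> clause d ` (UNIV \<times> {..d}). f B \<in> B"
    unfolding independent_transversal_def by blast
  define T where "T = literal d ` S"
  have consistent: "opposite d l \<notin> T" if "l \<in> T" for l
    using S(1) that
    by (auto simp: T_def independent_set_def arcs_ends_biclique_graph subset_iff) metis
  have pick: "\<exists>k < 2 * d - 1. slot_literal d (s, i, k) \<in> T" if "i \<le> d" for s i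
  proof -
    have "f (clause d (s, i)) \<in> clause d (s, i)" "f (clause d (s, i)) \<in> S"
      using f S(2) that by auto
    then obtain k where "k < 2 * d - 1" "to_nat (s, i, k) \<in> S"
      by (auto simp: clause_def)
    then show ?thesis
      unfolding T_def by (metis image_eqI literal_to_nat)
  qed
  \<comment> \<open>The literals \<open>x\<^sub>d\<close> of the two copies are opposite, so
    \<open>T\<close> misses one.\<close>
  obtain s where s: "(s, d, True) \<notin> T"
    using consistent[of "(True, d, True)"] by auto
  \<comment> \<open>With \<open>x\<^sub>j\<^sub>+\<^sub>1\<close> excluded, link \<open>j\<close>
    must pick the negation of \<open>x\<^sub>j\<close>.\<close>
  have "j \<le> d \<Longrightarrow> (s, j, True) \<notin> T" for j
  proof (induction j rule: inc_induct)
    case base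
    show ?case by (rule s)
  next
    case (step j)
    then have "(s, j, False) \<in> T"
      using pick[of j s] by (auto split: if_splits)
    with step show ?case
      using consistent[of "(s, j, False)"] by auto
  qed
  moreover obtain k where "k < 2 * d - 1" "(s, k + 2 - d, True) \<in> T"
    using pick[of d s] by auto
  ultimately show False
    by auto
qed

lemma occurrences_spread:
  assumes d: "d \<ge> 2"
    and occ: "card (occurrences (slots d) (literal d) l) = d"
      "card (occurrences (slots d) (literal d) (opposite d l)) = d"
  shows "\<not> occurrences (slots d) (literal d) l \<union> occurrences (slots d) (literal d) (opposite d l)
           \<subseteq> clause d c \<union> clause d c'"
proof -
  let ?O = "occurrences (slots d) (literal d)"
  have spread: "\<not> ?O (s, j, True) \<union> ?O (opposite d (s, j, True)) \<subseteq> clause d c \<union> clause d c'"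
    if "card (?O (s, j, True)) = d" for s j
  proof
    assume sub: "?O (s, j, True) \<union> ?O (opposite d (s, j, True)) \<subseteq> clause d c \<union> clause d c'"
    have j: "0 < j" "j \<le> d"
      using that d by (auto simp: occurrences_positive split: if_splits)
    have in_clause: "(s', i) \<in> {c, c'}"
      if "to_nat (s', i, k) \<in> ?O (s, j, True) \<union> ?O (opposite d (s, j, True))" for s' i and k :: nat
      using subsetD[OF sub that] by (auto simp: clause_def)
    have "to_nat (s, d, j + d - 2) \<in> ?O (s, j, True)"
      using j d by (auto simp: occurrences_def)
    then have 1: "(s, d) \<in> {c, c'}"
      using in_clause by blast
    have "to_nat (s, j - 1, d) \<in> ?O (s, j, True)"
      using j d by (auto simp: occurrences_def)
    then have 2: "(s, j - 1) \<in> {c, c'}"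
      using in_clause by blast
    \<comment> \<open>For \<open>j = d\<close> this is the last hub slot of the other copy:
      \<open>2 * d - 2 + 2 - d = d\<close>.\<close>
    have "to_nat (if j = d then \<not> s else s, j, if j = d then 2 * d - 2 else 0)
        \<in> ?O (opposite d (s, j, True))"
      using j d by (auto simp: occurrences_def)
    then have "(if j = d then \<not> s else s, j) \<in> {c, c'}"
      using in_clause by blast
    with 1 2 j show False
      by (auto split: if_splits)
  qed
  obtain s j b where l: "l = (s, j, b)"
    by (cases l)
  show ?thesis
  proof (cases b)
    case True
    with spread[of s j] occ l show ?thesis by simp
  next
    case False
    with occ(1) l d have "j \<noteq> d"
      by (auto simp: occurrences_negative)
    with False l have "opposite d l = (s, j, True)" "l = opposite d (s, j, True)"
      by auto
    with spread[of s j] occ(2) show ?thesis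
      by (simp add: Un_commute)
  qed
qed

theorem mainTheorem6:
  fixes d :: nat
  assumes "d \<ge> 2"
  shows "\<exists>(G :: (nat, nat \<times> nat) pre_digraph) (P :: nat set set).
           graph G \<and> verts G \<noteq> {} \<and> max_degree G = d \<and>
           partition_on (verts G) P \<and>
           (\<forall>B\<in>P. card B = 2 * d - 1) \<and>
           \<not> (\<exists>S. independent_transversal G P S) \<and>
           \<not> (\<exists>H. connected_component G H \<and> complete_bipartite_digraph d d H \<and>
                  (\<exists>B\<in>P. \<exists>C\<in>P. verts H \<subseteq> B \<union> C))"
proof -
  let ?V = "slots d"
  let ?G = "biclique_graph ?V (literal d) (opposite d)"
  let ?P = "clause d ` (UNIV \<times> {..d})"
  have le: "card (occurrences ?V (literal d) l) \<le> d" for l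
  proof -
    obtain s j b where "l = (s, j, b)" by (cases l)
    then show ?thesis
      using assms by (cases b) (auto simp: occurrences_positive occurrences_negative)
  qed
  \<comment> \<open>A slot of \<open>x\<^sub>d\<close>: its opposite occurs exactly \<open>d\<close>
    times.\<close>
  have "out_degree ?G (to_nat (True, d, 2 * d - 2)) = d" "to_nat (True, d, 2 * d - 2) \<in> ?V"
    using assms by (auto simp: out_degree_biclique_graph occurrences_positive)
  then have "d \<in> out_degree ?G ` ?V"
    by (metis image_eqI)
  then have deg: "max_degree ?G = d" "?V \<noteq> {}"
    unfolding max_degree_def
    by (auto intro!: Max_eqI simp: finite_slots out_degree_biclique_graph le)
  have "\<not> verts H \<subseteq> B \<union> C"
    if H: "connected_component ?G H" "complete_bipartite_digraph d d H" and BC: "B \<in> ?P" "C \<in> ?P"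
    for H B C
  proof -
    have "subgraph H ?G"
      using H(1) unfolding connected_component_def by (rule pre_digraph.subgraphI_max_subgraph)
    then obtain l where
        "verts H = occurrences ?V (literal d) l \<union> occurrences ?V (literal d) (opposite d l)"
        "card (occurrences ?V (literal d) l) = d" "card (occurrences ?V (literal d) (opposite d l)) = d"
      using complete_bipartite_subgraph_biclique_graph[OF finite_slots opposite_opposite[of d] le _ _ H(2)]
        assms by auto
    moreover obtain c c' where "B = clause d c" "C = clause d c'"
      using BC by blast
    ultimately show ?thesis
      using occurrences_spread[OF assms, of l c c'] by simp
  qed
  then show ?thesis
    using graph_biclique_graph[OF finite_slots[of d] opposite_opposite[of d] opposite_neq[of d], of "literal d"] deg
      partition_on_clauses[OF assms] no_independent_transversal[of d]
    by (intro exI[of _ ?G] exI[of _ ?P]) (auto simp: card_clause)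
qed

end
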